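(* Assume (PD) has a solution. Let $C>0$ and fix a perturbation $\lambda\in\mathbb{R}^n$, $\lambda\ge0$, such that $$0<\|\lambda\|<\min\left(1,\frac{C}{8\max(\tau_p,\tau_d)}\right).$$ Let $(x,y,s)\in\mathcal{F}^0_\lambda$ with $\mu_\lambda=\frac{(x+\lambda)^T(s+\lambda)}{n}$ sufficiently small, namely $$\mu_\lambda<\frac{C}{2C_2\max(\tau_p,\tau_d)}.$$ Then there exists a solution $(x^*,y^*,s^* )$ of (PD) such that $$\bar{\mathcal{A}}_+(s)\subseteq\mathcal{A}_+(s^* )\subseteq\mathcal{A}(x^* )\subseteq\bar{\mathcal{A}}(x).$$
   Context: Vector inequalities are componentwise; $\|\cdot\|$ is the Euclidean norm; $A\in\mathbb{R}^{m\times n}$ ($m\le n$), $b\in\mathbb{R}^m$, $c\in\mathbb{R}^n$. (PD): minimize $c^Tx$ s.t. $Ax=b$, $x\ge 0$; and its dual, maximize $b^Ty$ s.t. $A^Ty+s=c$, $s\ge0$. A solution of (PD) is a triple $(x^*,y^*,s^* )$ with $x^*$ primal optimal and $(y^*,s^* )$ dual optimal. For $\lambda\ge0$, (PD$_\lambda$): minimize $(c+\lambda)^T(x+\lambda)$ s.t. $Ax=b$, $x\ge-\lambda$; and its dual, maximize $(b+A\lambda)^Ty$ s.t. $A^Ty+s=c$, $s\ge-\lambda$. Its set of strictly feasible points is $\mathcal{F}^0_\lambda=\{(x,y,s): Ax=b,\ A^Ty+s=c,\ x+\lambda>0,\ s+\lambda>0\}$. Let $\Omega^P_\lambda$ and $\Omega^D_\lambda$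 be the primal and dual solution sets of (PD$_\lambda$), and let $(\mathcal{A}_\lambda,\mathcal{I}_\lambda)$ be the strictly complementary partition of $\{1,\dots,n\}$: $\mathcal{I}_\lambda=\{i: x_i+\lambda_i>0 \text{ for some } x\in\Omega^P_\lambda\}$, $\mathcal{A}_\lambda=\{i: s_i+\lambda_i>0\text{ for some }(y,s)\in\Omega^D_\lambda\}$. With $b_\lambda=b+A\lambda$, $c_\lambda=c+\lambda$, define $$\epsilon(A,b_\lambda,c_\lambda)=\min\Big(\min_{i\in\mathcal{I}_\lambda}\sup_{x\in\Omega^P_\lambda}(x_i+\lambda_i),\ \min_{i\in\mathcal{A}_\lambda}\sup_{(y,s)\in\Omega^D_\lambda}(s_i+\lambda_i)\Big)>0$$ (a minimum over an empty index set is $+\infty$), and $$C_2=\frac{n\sqrt n}{\epsilon(A,b_\lambda,c_\lambda)}+n .$$ $\tau_p,\tau_d>0$ are fixed constants depending only on $(A,b,c)$ with the property (such constants exist) that for every $\lambda\ge0$ and every $(x,y,s)\in\mathcal{F}^0_\lambda$ there is a solution $(x^*,y^*,s^* )$ of (PD) with $$\|x-x^*\|<\tau_p\big(C_2\mu_\lambda+4\|\lambda\|\max(\|\lambda\|,1)\big),\qquad \|s-s^*\|<\tau_d\big(C_2\mu_\lambda+4\|\lambda\|\max(\|\lambda\|,1)\big),$$ where $\mu_\lambda=(x+\lambda)^T(s+\lambda)/n$. Active sets: $\mathcal{A}(x^* )=\{i:x^*_i=0\}$, $\mathcal{A}_+(s^* )=\{i:s^*_i>0\}$. Predicted sets with threshold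 $C$: $\bar{\mathcal{A}}(x)=\{i:x_i<C\}$, $\bar{\mathcal{A}}_+(s)=\{i:s_i\ge C\}$. *)

theory Defs
  imports "HOL-Analysis.Analysis"
begin

text \<open>
  The order \<open>\<le>\<close> on \<^typ>\<open>real ^ 'n\<close> is the componentwise one.  The library's \<open><\<close> on this type is
  not componentwise, so strict vector inequalities are written out with a quantifier.
\<close>

definition primal_feasible :: "real ^ 'n ^ 'm \<Rightarrow> real ^ 'm \<Rightarrow> (real ^ 'n) set" where
  "primal_feasible A b = {x. A *v x = b \<and> 0 \<le> x}"

definition dual_feasible :: "real ^ 'n ^ 'm \<Rightarrow> real ^ 'n \<Rightarrow> ((real ^ 'm) \<times> (real ^ 'n)) set" where
  "dual_feasible A c = {(y, s). transpose A *v y + s = c \<and> 0 \<le> s}"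

definition primal_optimal ::
    "real ^ 'n ^ 'm \<Rightarrow> real ^ 'm \<Rightarrow> real ^ 'n \<Rightarrow> (real ^ 'n) set" where
  "primal_optimal A b c =
     {x \<in> primal_feasible A b. \<forall>x' \<in> primal_feasible A b. c \<bullet> x \<le> c \<bullet> x'}"

definition dual_optimal ::
    "real ^ 'n ^ 'm \<Rightarrow> real ^ 'm \<Rightarrow> real ^ 'n \<Rightarrow> ((real ^ 'm) \<times> (real ^ 'n)) set" where
  "dual_optimal A b c =
     {(y, s) \<in> dual_feasible A c. \<forall>(y', s') \<in> dual_feasible A c. b \<bullet> y' \<le> b \<bullet> y}"

definition pd_solutions ::
    "real ^ 'n ^ 'm \<Rightarrow> real ^ 'm \<Rightarrow> real ^ 'n \<Rightarrow> ((real ^ 'n) \<times> (real ^ 'm) \<times> (real ^ 'n)) set" where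
  "pd_solutions A b c = {(x, y, s). x \<in> primal_optimal A b c \<and> (y, s) \<in> dual_optimal A b c}"

definition pert_primal_feasible ::
    "real ^ 'n ^ 'm \<Rightarrow> real ^ 'm \<Rightarrow> real ^ 'n \<Rightarrow> (real ^ 'n) set" where
  "pert_primal_feasible A b l = {x. A *v x = b \<and> - l \<le> x}"

definition pert_dual_feasible ::
    "real ^ 'n ^ 'm \<Rightarrow> real ^ 'n \<Rightarrow> real ^ 'n \<Rightarrow> ((real ^ 'm) \<times> (real ^ 'n)) set" where
  "pert_dual_feasible A c l = {(y, s). transpose A *v y + s = c \<and> - l \<le> s}"

definition pert_primal_optimal ::
    "real ^ 'n ^ 'm \<Rightarrow> real ^ 'm \<Rightarrow> real ^ 'n \<Rightarrow> real ^ 'n \<Rightarrow> (real ^ 'n) set" where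
  "pert_primal_optimal A b c l =
     {x \<in> pert_primal_feasible A b l.
        \<forall>x' \<in> pert_primal_feasible A b l. (c + l) \<bullet> (x + l) \<le> (c + l) \<bullet> (x' + l)}"

definition pert_dual_optimal ::
    "real ^ 'n ^ 'm \<Rightarrow> real ^ 'm \<Rightarrow> real ^ 'n \<Rightarrow> real ^ 'n \<Rightarrow> ((real ^ 'm) \<times> (real ^ 'n)) set" where
  "pert_dual_optimal A b c l =
     {(y, s) \<in> pert_dual_feasible A c l.
        \<forall>(y', s') \<in> pert_dual_feasible A c l. (b + A *v l) \<bullet> y' \<le> (b + A *v l) \<bullet> y}"

definition strictly_feasible ::
    "real ^ 'n ^ 'm \<Rightarrow> real ^ 'm \<Rightarrow> real ^ 'n \<Rightarrow> real ^ 'n \<Rightarrow>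
      ((real ^ 'n) \<times> (real ^ 'm) \<times> (real ^ 'n)) set" where
  "strictly_feasible A b c l =
     {(x, y, s). A *v x = b \<and> transpose A *v y + s = c \<and>
                 (\<forall>i. (x + l) $ i > 0) \<and> (\<forall>i. (s + l) $ i > 0)}"

definition inactive_part ::
    "real ^ 'n ^ 'm \<Rightarrow> real ^ 'm \<Rightarrow> real ^ 'n \<Rightarrow> real ^ 'n \<Rightarrow> 'n set" where
  "inactive_part A b c l = {i. \<exists>x \<in> pert_primal_optimal A b c l. x $ i + l $ i > 0}"

definition active_part ::
    "real ^ 'n ^ 'm \<Rightarrow> real ^ 'm \<Rightarrow> real ^ 'n \<Rightarrow> real ^ 'n \<Rightarrow> 'n set" where
  "active_part A b c l = {i. \<exists>(y, s) \<in> pert_dual_optimal A b c l. s $ i + l $ i > 0}"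

text \<open>
  Extended reals make the infimum over an empty index set equal to \<open>\<infinity>\<close> and leave the suprema
  unrestricted; the index sets are finite, so the outer infima are minima.
\<close>

definition eps_cond ::
    "real ^ 'n ^ 'm \<Rightarrow> real ^ 'm \<Rightarrow> real ^ 'n \<Rightarrow> real ^ 'n \<Rightarrow> ereal" where
  "eps_cond A b c l =
     min (INF i \<in> inactive_part A b c l.
            SUP x \<in> pert_primal_optimal A b c l. ereal (x $ i + l $ i))
         (INF i \<in> active_part A b c l.
            SUP (y, s) \<in> pert_dual_optimal A b c l. ereal (s $ i + l $ i))"

definition C2 :: "real ^ 'n ^ 'm \<Rightarrow> real ^ 'm \<Rightarrow> real ^ 'n \<Rightarrow> real ^ 'n \<Rightarrow> real" where
  "C2 A b c l =
     real_of_ereal (ereal (real CARD('n) * sqrt (real CARD('n))) / eps_cond A b c l)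
       + real CARD('n)"

definition mu :: "real ^ 'n \<Rightarrow> real ^ 'n \<Rightarrow> real ^ 'n \<Rightarrow> real" where
  "mu l x s = ((x + l) \<bullet> (s + l)) / real CARD('n)"

definition error_bound_constants ::
    "real ^ 'n ^ 'm \<Rightarrow> real ^ 'm \<Rightarrow> real ^ 'n \<Rightarrow> real \<Rightarrow> real \<Rightarrow> bool" where
  "error_bound_constants A b c \<tau>p \<tau>d \<longleftrightarrow>
     \<tau>p > 0 \<and> \<tau>d > 0 \<and>
     (\<forall>l x y s. 0 \<le> l \<longrightarrow> (x, y, s) \<in> strictly_feasible A b c l \<longrightarrow>
        (\<exists>(x', y', s') \<in> pd_solutions A b c.
           norm (x - x') < \<tau>p * (C2 A b c l * mu l x s + 4 * norm l * max (norm l) 1) \<and>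
           norm (s - s') < \<tau>d * (C2 A b c l * mu l x s + 4 * norm l * max (norm l) 1)))"

definition active_set :: "real ^ 'n \<Rightarrow> 'n set" where
  "active_set x = {i. x $ i = 0}"

definition strongly_active_set :: "real ^ 'n \<Rightarrow> 'n set" where
  "strongly_active_set s = {i. s $ i > 0}"

definition predicted_active :: "real \<Rightarrow> real ^ 'n \<Rightarrow> 'n set" where
  "predicted_active C x = {i. x $ i < C}"

definition predicted_strongly_active :: "real \<Rightarrow> real ^ 'n \<Rightarrow> 'n set" where
  "predicted_strongly_active C s = {i. s $ i \<ge> C}"

end

theory Submission
  imports Defs
begin

text \<open>
  The error bound places some solution of the unperturbed problem near the strictly feasible point.
  The hypotheses on \<open>\<parallel>\<lambda>\<parallel>\<close> and \<open>\<mu>\<^sub>\<lambda>\<close> each make one of the two terms of that bound contribute less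
  than \<open>C / 2\<close>, so every component of \<open>x\<close> and of \<open>s\<close> is within \<open>C\<close> of the corresponding component
  of the solution; hence a component \<open>s\<^sub>i \<ge> C\<close> forces a positive solution component, and a vanishing
  solution component forces \<open>x\<^sub>i < C\<close>. This yields the two outer inclusions.

  The middle inclusion is complementarity of the solution, that is, strong duality. Because the
  solution comes with an attained dual optimum, it is enough to show that this optimum is not strictly
  below the primal optimal value. If it were, then \<open>b\<close> paired with the dual optimal value would lie
  outside the closed cone of attainable pairs (right-hand side, objective value), and a separating
  hyperplane, normalised, would be a dual feasible point with a larger objective value
  (\<open>dual_point_above_value\<close>).
\<close>

section \<open>Strong duality and complementarity\<close>

lemma nonneg_orthant_eq_convex_cone_hull:
  "{x :: real ^ 'n. 0 \<le> x} = convex_cone hull range (\<lambda>i. axis i 1)" (is "?L = convex_cone hull ?S")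
proof (rule antisym)
  show "?L \<subseteq> convex_cone hull ?S"
  proof
    fix x :: "real ^ 'n" assume "x \<in> ?L"
    then have "x $ i *\<^sub>R axis i 1 \<in> convex_cone hull ?S" for i
      by (intro convex_cone_hull_mul hull_inc) (auto simp: less_eq_vec_def)
    then have "(\<Sum>i\<in>I. x $ i *\<^sub>R axis i 1) \<in> convex_cone hull ?S" for I :: "'n set"
      by (induction I rule: infinite_finite_induct)
        (simp_all add: convex_cone_hull_contains_0 convex_cone_hull_add)
    moreover have "(\<Sum>i\<in>UNIV. x $ i *\<^sub>R axis i 1) = x"
      using basis_expansion[of x] by (simp add: scalar_mult_eq_scaleR)
    ultimately show "x \<in> convex_cone hull ?S" by metis
  qed
next
  have "convex_cone ?L"
    by (auto simp: convex_cone_iff less_eq_vec_def)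
  then show "convex_cone hull ?S \<subseteq> ?L"
    by (intro hull_minimal) (auto simp: less_eq_vec_def axis_def)
qed

lemma inner_nonneg_cart:
  fixes x s :: "real ^ 'n"
  assumes "0 \<le> x" "0 \<le> s"
  shows "0 \<le> x \<bullet> s"
  using assms by (auto simp: inner_vec_def less_eq_vec_def intro!: sum_nonneg)

text \<open>
  The set \<open>{(A x, c \<bullet> x) | x \<ge> 0}\<close> is the cone generated by finitely many vectors, the images of the
  unit vectors, so it is closed and the point \<open>(b, v)\<close> outside it can be separated strictly. Its being
  a cone moves the hyperplane to the origin. The coefficient \<open>t\<close> of the objective is positive, since
  \<open>(b, c \<bullet> x)\<close> lies in the cone directly above \<open>(b, v)\<close>; dividing the other coefficients by \<open>- t\<close>
  gives the dual variables.
\<close>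

lemma dual_point_above_value:
  fixes A :: "real ^ 'n ^ 'm"
  assumes x: "x \<in> primal_optimal A b c" and v: "v < c \<bullet> x"
  obtains y s where "(y, s) \<in> dual_feasible A c" "v < b \<bullet> y"
proof -
  define h where "h = (\<lambda>x. (A *v x, c \<bullet> x))"
  define K where "K = h ` {x. 0 \<le> x}"
  have Ax: "A *v x = b" and x0: "0 \<le> x"
    and opt: "\<And>z. A *v z = b \<Longrightarrow> 0 \<le> z \<Longrightarrow> c \<bullet> x \<le> c \<bullet> z"
    using x by (auto simp: primal_optimal_def primal_feasible_def)
  have lin: "linear h"
    unfolding h_def by (auto intro!: linearI simp: matrix_vector_right_distrib inner_add_right
        matrix_vector_mult_scaleR)
  have "K = convex_cone hull (h ` range (\<lambda>i. axis i 1))"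
    by (simp add: K_def nonneg_orthant_eq_convex_cone_hull convex_cone_hull_linear_image[OF lin])
  then have K: "closed K" "convex K"
    by (simp_all add: closed_convex_cone_hull convex_convex_cone_hull)
  have "(b, v) \<notin> K"
    using opt v by (force simp: K_def h_def)
  then obtain a \<beta> where a: "a \<bullet> (b, v) < \<beta>" "\<And>k. k \<in> K \<Longrightarrow> a \<bullet> k > \<beta>"
    using separating_hyperplane_closed_point[OF K(2,1)] by blast
  obtain w t where wt: "a = (w, t)" by force
  have "0 \<in> K"
    unfolding K_def using linear_0[OF lin] by (metis (mono_tags) image_eqI mem_Collect_eq order_refl)
  then have \<beta>: "\<beta> < 0" using a(2) by fastforce
  have cone: "0 \<le> w \<bullet> (A *v z) + t * (c \<bullet> z)" if "0 \<le> z" for z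
  proof (rule ccontr)
    \<comment> \<open>A negative value could be scaled along the ray through \<open>z\<close> down to \<open>\<beta>\<close> itself.\<close>
    define q where "q = w \<bullet> (A *v z) + t * (c \<bullet> z)"
    assume "\<not> 0 \<le> w \<bullet> (A *v z) + t * (c \<bullet> z)"
    then have q: "q < 0" by (simp add: q_def)
    have "0 \<le> (\<beta> / q) *\<^sub>R z"
      using that \<beta> q
      by (auto simp: less_eq_vec_def intro!: mult_nonpos_nonneg divide_nonpos_nonpos)
    then have "a \<bullet> h ((\<beta> / q) *\<^sub>R z) > \<beta>"
      by (intro a(2)) (auto simp: K_def)
    moreover have "a \<bullet> h ((\<beta> / q) *\<^sub>R z) = (\<beta> / q) * q"
      by (simp add: h_def wt q_def matrix_vector_mult_scaleR algebra_simps add_divide_distrib)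
    ultimately show False using q by simp
  qed
  have below: "w \<bullet> b + t * v < 0"
    using a(1) \<beta> by (simp add: wt)
  have "0 < t * (c \<bullet> x - v)"
    using cone[OF x0] below by (simp add: Ax algebra_simps)
  then have t: "t > 0"
    using v by (simp add: zero_less_mult_iff)
  define y where "y = - (1 / t) *\<^sub>R w"
  have "0 \<le> (c - transpose A *v y) $ i" for i
  proof -
    have "0 \<le> w \<bullet> (A *v axis i 1) + t * (c \<bullet> axis i 1)"
      by (rule cone) (auto simp: less_eq_vec_def axis_def)
    also have "w \<bullet> (A *v axis i 1) = (transpose A *v w) $ i"
      by (metis dot_lmul_matrix inner_axis inner_real_def mult.right_neutral transpose_matrix_vector)
    finally have "0 \<le> (transpose A *v w) $ i + t * c $ i"
      by (simp add: inner_axis)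
    moreover have "(c - transpose A *v y) $ i = ((transpose A *v w) $ i + t * c $ i) / t"
      using t by (simp add: y_def vec.neg vector_scaleR_matrix_ac matrix_vector_mult_scaleR field_simps)
    ultimately show ?thesis using t by simp
  qed
  then have "(y, c - transpose A *v y) \<in> dual_feasible A c"
    by (simp add: dual_feasible_def less_eq_vec_def)
  moreover have "v < b \<bullet> y"
    using below t by (simp add: y_def field_simps inner_commute)
  ultimately show thesis by (rule that)
qed

text \<open>
  For feasible points \<open>x \<bullet> s\<close> is the duality gap \<open>c \<bullet> x - b \<bullet> y\<close>, which strong duality annihilates.
\<close>

lemma pd_solutions_complementary:
  assumes "(x, y, s) \<in> pd_solutions A b c"
  shows "x \<bullet> s = 0"
proof -
  have px: "x \<in> primal_optimal A b c" and "A *v x = b" "0 \<le> x"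
    and "transpose A *v y + s = c" "0 \<le> s"
    and dual: "\<And>y' s'. (y', s') \<in> dual_feasible A c \<Longrightarrow> b \<bullet> y' \<le> b \<bullet> y"
    using assms by (auto simp: pd_solutions_def primal_optimal_def primal_feasible_def
        dual_optimal_def dual_feasible_def)
  have "y \<bullet> (A *v x) = (transpose A *v y) \<bullet> x"
    by (metis dot_lmul_matrix transpose_matrix_vector)
  then have gap: "x \<bullet> s = c \<bullet> x - b \<bullet> y"
    using \<open>A *v x = b\<close> \<open>transpose A *v y + s = c\<close>
    by (auto simp: inner_commute inner_add_right)
  have "c \<bullet> x \<le> b \<bullet> y"
  proof (rule ccontr)
    assume "\<not> c \<bullet> x \<le> b \<bullet> y"
    then obtain y' s' where "(y', s') \<in> dual_feasible A c" "b \<bullet> y < b \<bullet> y'"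
      using dual_point_above_value[OF px] by (metis not_le)
    then show False using dual by force
  qed
  then show ?thesis
    using gap inner_nonneg_cart[OF \<open>0 \<le> x\<close> \<open>0 \<le> s\<close>] by simp
qed

corollary strongly_active_subset_active:
  assumes "(x, y, s) \<in> pd_solutions A b c"
  shows "strongly_active_set s \<subseteq> active_set x"
proof -
  have "0 \<le> x" "0 \<le> s"
    using assms by (auto simp: pd_solutions_def primal_optimal_def primal_feasible_def
        dual_optimal_def dual_feasible_def)
  then have "\<forall>i \<in> UNIV. x $ i * s $ i = 0"
    using pd_solutions_complementary[OF assms]
    by (subst (asm) inner_vec_def, subst (asm) sum_nonneg_eq_0_iff) (auto simp: less_eq_vec_def)
  then show ?thesis
    by (force simp: strongly_active_set_def active_set_def)
qed

section \<open>The error bound under the smallness hypotheses\<close>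

text \<open>
  Each index in the strictly complementary partition is witnessed by a solution with a positive
  component, which bounds its supremum from below.
\<close>

lemma eps_cond_nonneg: "0 \<le> eps_cond A b c l"
proof -
  have "0 \<le> (SUP x \<in> pert_primal_optimal A b c l. ereal (x $ i + l $ i))"
    if i: "i \<in> inactive_part A b c l" for i
  proof -
    obtain x where "x \<in> pert_primal_optimal A b c l" "x $ i + l $ i > 0"
      using i by (auto simp: inactive_part_def)
    then show ?thesis by (intro SUP_upper2[of x]) auto
  qed
  moreover have "0 \<le> (SUP (y, s) \<in> pert_dual_optimal A b c l. ereal (s $ i + l $ i))"
    if i: "i \<in> active_part A b c l" for i
  proof -
    obtain y s where "(y, s) \<in> pert_dual_optimal A b c l" "s $ i + l $ i > 0"
      using i by (auto simp: active_part_def)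
    then show ?thesis by (intro SUP_upper2[of "(y, s)"]) auto
  qed
  ultimately show ?thesis
    unfolding eps_cond_def by (auto intro!: INF_greatest)
qed

text \<open>
  The summand \<open>n\<close> makes this strict whatever the quotient is: conversion to the reals sends an infinite
  quotient to \<open>0\<close>, and an infinite \<open>eps_cond\<close> makes the quotient itself \<open>0\<close>.
\<close>

lemma C2_pos: "0 < C2 A b c (l :: real ^ 'n)"
proof -
  have "0 \<le> ereal (real CARD('n) * sqrt (real CARD('n))) / eps_cond A b c l"
    using eps_cond_nonneg[of A b c l] by (simp add: divide_ereal_def ereal_inverse_nonneg_iff)
  then have "0 \<le> real_of_ereal (ereal (real CARD('n) * sqrt (real CARD('n))) / eps_cond A b c l)"
    by (rule real_of_ereal_pos)
  then show ?thesis
    unfolding C2_def by (simp add: add_nonneg_pos)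
qed

text \<open>Here \<open>K\<close>, \<open>\<mu>\<close>, \<open>r\<close> stand for \<open>C\<^sub>2\<close>, \<open>\<mu>\<^sub>\<lambda>\<close>, \<open>\<parallel>\<lambda>\<parallel>\<close>, and \<open>\<tau>\<close> for either error constant.\<close>

lemma error_bound_less_threshold:
  fixes \<tau> T C K \<mu> r :: real
  assumes "0 < \<tau>" "\<tau> \<le> T" "0 < C" "0 < K" "r < min 1 (C / (8 * T))" "\<mu> < C / (2 * K * T)"
  shows "\<tau> * (K * \<mu> + 4 * r * max r 1) < C"
proof -
  have T: "0 < T" using assms by simp
  have r: "4 * r * max r 1 < C / (2 * T)"
    using assms T by (simp add: pos_less_divide_eq max_def algebra_simps)
  have "K * \<mu> < C / (2 * T)"
    using assms T by (simp add: pos_less_divide_eq algebra_simps)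
  then have "K * \<mu> + 4 * r * max r 1 < C / T"
    using r by (simp add: field_simps)
  then have "\<tau> * (K * \<mu> + 4 * r * max r 1) < \<tau> * (C / T)"
    using assms by (intro mult_strict_left_mono) auto
  also have "\<dots> \<le> C"
    using assms T by (simp add: field_simps)
  finally show ?thesis .
qed

section \<open>Prediction of the active sets\<close>

theorem theorem4:
  fixes A :: "real ^ 'n ^ 'm" and b :: "real ^ 'm" and c :: "real ^ 'n"
    and l x s :: "real ^ 'n" and y :: "real ^ 'm"
    and C \<tau>p \<tau>d :: real
  assumes "CARD('m) \<le> CARD('n)"
    and "pd_solutions A b c \<noteq> {}"
    and "error_bound_constants A b c \<tau>p \<tau>d"
    and "C > 0"
    and "0 \<le> l"
    and "0 < norm l" and "norm l < min 1 (C / (8 * max \<tau>p \<tau>d))"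
    and "(x, y, s) \<in> strictly_feasible A b c l"
    and "mu l x s < C / (2 * C2 A b c l * max \<tau>p \<tau>d)"
  shows "\<exists>(x', y', s') \<in> pd_solutions A b c.
           predicted_strongly_active C s \<subseteq> strongly_active_set s' \<and>
           strongly_active_set s' \<subseteq> active_set x' \<and>
           active_set x' \<subseteq> predicted_active C x"
proof -
  define bound where "bound = C2 A b c l * mu l x s + 4 * norm l * max (norm l) 1"
  have \<tau>: "\<tau>p > 0" "\<tau>d > 0"
    using assms(3) by (auto simp: error_bound_constants_def)
  obtain x' y' s' where sol: "(x', y', s') \<in> pd_solutions A b c"
    and "norm (x - x') < \<tau>p * bound" and "norm (s - s') < \<tau>d * bound"
    using assms(3,5,8) unfolding error_bound_constants_def bound_def by fastforce
  moreover have "\<tau>p * bound < C" "\<tau>d * bound < C"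
    unfolding bound_def
    by (rule error_bound_less_threshold[OF _ _ assms(4) C2_pos assms(7,9)]; use \<tau> in simp)+
  ultimately have near: "\<bar>(x - x') $ i\<bar> < C" "\<bar>(s - s') $ i\<bar> < C" for i
    using component_le_norm_cart[of "x - x'" i] component_le_norm_cart[of "s - s'" i] by linarith+
  have "predicted_strongly_active C s \<subseteq> strongly_active_set s'"
  proof
    fix i assume "i \<in> predicted_strongly_active C s"
    then show "i \<in> strongly_active_set s'"
      using near(2)[of i] by (simp add: predicted_strongly_active_def strongly_active_set_def)
  qed
  moreover have "active_set x' \<subseteq> predicted_active C x"
  proof
    fix i assume "i \<in> active_set x'"
    then show "i \<in> predicted_active C x"
      using near(1)[of i] by (simp add: active_set_def predicted_active_def)
  qed
  ultimately show ?thesis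
    using sol strongly_active_subset_active[OF sol] by blast
qed

end
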